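(* Let $S\subseteq\mathbb{H}$ and suppose $g:S\to\mathbb{H}$ has the right GHR derivative at an interior point $q$ of the set $S$. Let $T\subseteq\mathbb{H}$ be such that $g(q)\in T$ for all $q\in S$. Assume $f:T\to\mathbb{H}$ has right GHR derivatives at an inner point $g(q)\in T$. Then the right GHR derivatives of the composite function $f(g(q))$ are as follows: $$\frac{\partial_r f(g(q))}{\partial q^{\mu}}=\frac{\partial_r g^{\nu}}{\partial q^{\mu}}\frac{\partial_r f}{\partial g^{\nu}}+\frac{\partial_r g^{\nu i}}{\partial q^{\mu}}\frac{\partial_r f}{\partial g^{\nu i}}+\frac{\partial_r g^{\nu j}}{\partial q^{\mu}}\frac{\partial_r f}{\partial g^{\nu j}}+\frac{\partial_r g^{\nu k}}{\partial q^{\mu}}\frac{\partial_r f}{\partial g^{\nu k}},$$ $$\frac{\partial_r f(g(q))}{\partial q^{\mu*}}=\frac{\partial_r g^{\nu}}{\partial q^{\mu*}}\frac{\partial_r f}{\partial g^{\nu}}+\frac{\partial_r g^{\nu i}}{\partial q^{\mu*}}\frac{\partial_r f}{\partial g^{\nu i}}+\frac{\partial_r g^{\nu j}}{\partial q^{\mu*}}\frac{\partial_r f}{\partial g^{\nu j}}+\frac{\partial_r g^{\nu k}}{\partial q^{\mu*}}\frac{\partial_r f}{\partial g^{\nu k}},$$ and $$\frac{\partial_r f(g(q))}{\partial q^{\mu}}=\frac{\partial_r g^{\nu*}}{\partial q^{\mu}}\frac{\partial_r f}{\partial g^{\nu*}}+\frac{\partial_r g^{\nu i*}}{\partial q^{\mu}}\frac{\partial_r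 f}{\partial g^{\nu i*}}+\frac{\partial_r g^{\nu j*}}{\partial q^{\mu}}\frac{\partial_r f}{\partial g^{\nu j*}}+\frac{\partial_r g^{\nu k*}}{\partial q^{\mu}}\frac{\partial_r f}{\partial g^{\nu k*}},$$ $$\frac{\partial_r f(g(q))}{\partial q^{\mu*}}=\frac{\partial_r g^{\nu*}}{\partial q^{\mu*}}\frac{\partial_r f}{\partial g^{\nu*}}+\frac{\partial_r g^{\nu i*}}{\partial q^{\mu*}}\frac{\partial_r f}{\partial g^{\nu i*}}+\frac{\partial_r g^{\nu j*}}{\partial q^{\mu*}}\frac{\partial_r f}{\partial g^{\nu j*}}+\frac{\partial_r g^{\nu k*}}{\partial q^{\mu*}}\frac{\partial_r f}{\partial g^{\nu k*}},$$ where $\mu,\nu\in\mathbb{H}$, $\mu\nu\neq0$.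
   Context: $\mathbb{H}$ denotes the real quaternions $q=q_a+iq_b+jq_c+kq_d$ with $q_a,q_b,q_c,q_d\in\mathbb{R}$ and $i^2=j^2=k^2=ijk=-1$. The conjugate is $q^*=q_a-iq_b-jq_c-kq_d$. For $\mu\in\mathbb{H}$, $\mu\ne0$, and $p\in\mathbb{H}$, write $p^{\mu}:=\mu p\mu^{-1}$ and $p^{\mu*}:=(p^{\mu})^*$; a product in the exponent, such as $p^{\nu i}$, means rotation by the quaternion product $\nu i$, and $p^{\nu i*}=(p^{\nu i})^*$. For a function $g$, $g^{\nu}$ is the function $p\mapsto (g(p))^{\nu}$ and $g^{\nu*}$ the function $p\mapsto (g(p))^{\nu*}$. An $\mathbb{H}$-valued function $f$ is regarded as a function of the four real variables $q_a,q_b,q_c,q_d$, with ($\mathbb{H}$-valued) partial derivatives $\frac{\partial f}{\partial q_a},\dots,\frac{\partial f}{\partial q_d}$. For $\mu\neq0$ the right GHR derivatives of $f$ with respect to $q^{\mu}$ and $q^{\mu*}$ are $$\frac{\partial_r f}{\partial q^{\mu}}=\frac14\left(\frac{\partial f}{\partial q_a}-i^{\mu}\frac{\partial f}{\partial q_b}-j^{\mu}\frac{\partial f}{\partial q_c}-k^{\mu}\frac{\partial f}{\partial q_d}\right),\qquad \frac{\partial_r f}{\partial q^{\mu*}}=\frac14\left(\frac{\partial f}{\partial q_a}+i^{\mu}\frac{\partial f}{\partial q_b}+j^{\mu}\frac{\partial f}{\partial q_c}+k^{\mu}\frac{\partial f}{\partial q_d}\right).$$ The symbols $\frac{\partial_r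 f}{\partial g^{\nu}}$, $\frac{\partial_r f}{\partial g^{\nu*}}$ (and likewise with $\nu i,\nu j,\nu k$) denote the right GHR derivatives of $f$ with respect to its own variable, with parameter $\nu$, evaluated at the point $g(q)$.
   Formalization: The outer function f is additionally assumed to be real-differentiable (as a function of four real variables) at g(q); with only the partial derivatives in the GHR definition, the composite may fail to have GHR derivatives. *)

theory Defs
  imports "HOL-Analysis.Analysis"
begin

section \<open>The real quaternions\<close>

datatype quat = Quat (qa: real) (qb: real) (qc: real) (qd: real)

lemma quat_eq_iff: "x = y \<longleftrightarrow> qa x = qa y \<and> qb x = qb y \<and> qc x = qc y \<and> qd x = qd y"
  by (cases x; cases y) auto

lemma quat_eqI: "qa x = qa y \<Longrightarrow> qb x = qb y \<Longrightarrow> qc x = qc y \<Longrightarrow> qd x = qd y \<Longrightarrow> x = y"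
  by (simp add: quat_eq_iff)

instantiation quat :: ab_group_add
begin

definition zero_quat where "0 = Quat 0 0 0 0"
definition plus_quat where "x + y = Quat (qa x + qa y) (qb x + qb y) (qc x + qc y) (qd x + qd y)"
definition uminus_quat where "- x = Quat (- qa x) (- qb x) (- qc x) (- qd x)"
definition minus_quat where "x - y = Quat (qa x - qa y) (qb x - qb y) (qc x - qc y) (qd x - qd y)"

instance
  by standard (simp_all add: quat_eq_iff zero_quat_def plus_quat_def uminus_quat_def minus_quat_def)

end

instantiation quat :: real_vector
begin

definition scaleR_quat where "r *\<^sub>R x = Quat (r * qa x) (r * qb x) (r * qc x) (r * qd x)"

instance
  by standard (simp_all add: quat_eq_iff plus_quat_def scaleR_quat_def algebra_simps)

end

lemma quat_sel_linear [simp]: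
  "qa 0 = 0" "qb 0 = 0" "qc 0 = 0" "qd 0 = 0"
  "qa (x + y) = qa x + qa y" "qb (x + y) = qb x + qb y"
  "qc (x + y) = qc x + qc y" "qd (x + y) = qd x + qd y"
  "qa (- x) = - qa x" "qb (- x) = - qb x" "qc (- x) = - qc x" "qd (- x) = - qd x"
  "qa (x - y) = qa x - qa y" "qb (x - y) = qb x - qb y"
  "qc (x - y) = qc x - qc y" "qd (x - y) = qd x - qd y"
  "qa (r *\<^sub>R x) = r * qa x" "qb (r *\<^sub>R x) = r * qb x"
  "qc (r *\<^sub>R x) = r * qc x" "qd (r *\<^sub>R x) = r * qd x"
  by (simp_all add: zero_quat_def plus_quat_def uminus_quat_def minus_quat_def scaleR_quat_def)

instantiation quat :: real_algebra_1
begin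

definition one_quat where "1 = Quat 1 0 0 0"

definition times_quat where
  "x * y = Quat
     (qa x * qa y - qb x * qb y - qc x * qc y - qd x * qd y)
     (qa x * qb y + qb x * qa y + qc x * qd y - qd x * qc y)
     (qa x * qc y - qb x * qd y + qc x * qa y + qd x * qb y)
     (qa x * qd y + qb x * qc y - qc x * qb y + qd x * qa y)"

instance
  by standard (simp_all add: quat_eq_iff one_quat_def times_quat_def algebra_simps)

end

lemma quat_sel_one [simp]: "qa 1 = 1" "qb 1 = 0" "qc 1 = 0" "qd 1 = 0"
  by (simp_all add: one_quat_def)

lemma quat_sel_times [simp]:
  "qa (x * y) = qa x * qa y - qb x * qb y - qc x * qc y - qd x * qd y"
  "qb (x * y) = qa x * qb y + qb x * qa y + qc x * qd y - qd x * qc y"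
  "qc (x * y) = qa x * qc y - qb x * qd y + qc x * qa y + qd x * qb y"
  "qd (x * y) = qa x * qd y + qb x * qc y - qc x * qb y + qd x * qa y"
  by (simp_all add: times_quat_def)

instantiation quat :: real_normed_vector
begin

definition norm_quat where
  "norm x = sqrt ((qa x)\<^sup>2 + (qb x)\<^sup>2 + (qc x)\<^sup>2 + (qd x)\<^sup>2)"
definition dist_quat where "dist x y = norm (x - y :: quat)"
definition sgn_quat where "sgn x = (x :: quat) /\<^sub>R norm x"

definition uniformity_quat where
  "(uniformity :: (quat \<times> quat) filter) = (INF e\<in>{0 <..}. principal {(x, y). dist x y < e})"

definition open_quat where
  "open (U :: quat set) \<longleftrightarrow> (\<forall>x\<in>U. eventually (\<lambda>(x', y). x' = x \<longrightarrow> y \<in> U) uniformity)"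

instance
proof
  fix x y :: quat and r :: real
  have eq: "norm z = norm ((qa z, qb z), (qc z, qd z))" for z
    by (simp add: norm_quat_def norm_Pair add.assoc)
  show "norm x = 0 \<longleftrightarrow> x = 0"
    by (simp add: eq quat_eq_iff norm_prod_def add_nonneg_eq_0_iff)
  show "norm (x + y) \<le> norm x + norm y"
    unfolding eq using norm_triangle_ineq [of "((qa x, qb x), (qc x, qd x))" "((qa y, qb y), (qc y, qd y))"]
    by simp
  show "norm (r *\<^sub>R x) = \<bar>r\<bar> * norm x"
    unfolding eq using norm_scaleR [of r "((qa x, qb x), (qc x, qd x))"] by simp
qed (fact dist_quat_def sgn_quat_def uniformity_quat_def open_quat_def)+

end

instantiation quat :: real_normed_div_algebra
begin

definition inverse_quat where
  "inverse x = Quat (qa x) (- qb x) (- qc x) (- qd x) /\<^sub>R (norm x)\<^sup>2"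

definition divide_quat where "x div y = (x :: quat) * inverse y"

instance
proof
  fix x y :: quat
  show "inverse 0 = (0 :: quat)"
    by (simp add: inverse_quat_def)
  show "x div y = x * inverse y"
    by (fact divide_quat_def)
  show "norm (x * y) = norm x * norm y"
    unfolding norm_quat_def real_sqrt_mult [symmetric]
    by (simp add: power2_eq_square algebra_simps)
  assume "x \<noteq> 0"
  then have "inverse ((norm x)\<^sup>2) * (norm x)\<^sup>2 = 1"
    by simp
  then have *: "inverse ((norm x)\<^sup>2) * (qa x * qa x + qb x * qb x + qc x * qc x + qd x * qd x) = 1"
    by (simp add: norm_quat_def power2_eq_square)
  show "inverse x * x = 1" "x * inverse x = 1"
    using * by (simp_all add: quat_eq_iff inverse_quat_def algebra_simps)
qed

end

instantiation quat :: real_inner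
begin

definition inner_quat where
  "x \<bullet> y = qa x * qa y + qb x * qb y + qc x * qc y + qd x * qd y"

instance
proof
  fix x y z :: quat and r :: real
  show "x \<bullet> y = y \<bullet> x" "(x + y) \<bullet> z = x \<bullet> z + y \<bullet> z" "(r *\<^sub>R x) \<bullet> y = r * (x \<bullet> y)"
    by (simp_all add: inner_quat_def algebra_simps)
  have *: "x \<bullet> x = (norm x)\<^sup>2"
    by (simp add: inner_quat_def norm_quat_def power2_eq_square)
  show "0 \<le> x \<bullet> x" "x \<bullet> x = 0 \<longleftrightarrow> x = 0" "norm x = sqrt (x \<bullet> x)"
    by (simp_all add: *)
qed

end

definition qi :: quat where "qi = Quat 0 1 0 0"
definition qj :: quat where "qj = Quat 0 0 1 0"
definition qk :: quat where "qk = Quat 0 0 0 1"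

lemma quat_units:
  "qi * qi = -1" "qj * qj = -1" "qk * qk = -1" "qi * qj * qk = -1"
  by (simp_all add: quat_eq_iff qi_def qj_def qk_def)

lemma quat_decomp:
  "q = of_real (qa q) + qi * of_real (qb q) + qj * of_real (qc q) + qk * of_real (qd q)"
  by (simp add: quat_eq_iff of_real_def qi_def qj_def qk_def)

definition qconj :: "quat \<Rightarrow> quat" where
  "qconj q = of_real (qa q) - qi * of_real (qb q) - qj * of_real (qc q) - qk * of_real (qd q)"

definition qrot :: "quat \<Rightarrow> quat \<Rightarrow> quat" where
  "qrot \<mu> p = \<mu> * p * inverse \<mu>"

section \<open>Right GHR derivatives\<close>

text \<open>
  Adding a real multiple of \<open>1\<close>, \<open>qi\<close>, \<open>qj\<close> or \<open>qk\<close> to \<open>q\<close> changes exactly one of its four real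
  coordinates. The partial derivatives of \<open>f\<close> at \<open>q\<close> are therefore \<open>partial_deriv f e q\<close> with
  \<open>e\<close> one of these four quaternions. They are only meaningful if \<open>has_partials f q\<close>.
\<close>

definition partial_deriv :: "(quat \<Rightarrow> quat) \<Rightarrow> quat \<Rightarrow> quat \<Rightarrow> quat" where
  "partial_deriv f e q = vector_derivative (\<lambda>t. f (q + t *\<^sub>R e)) (at 0)"

definition has_partials :: "(quat \<Rightarrow> quat) \<Rightarrow> quat \<Rightarrow> bool" where
  "has_partials f q \<longleftrightarrow> (\<forall>e\<in>{1, qi, qj, qk}. (\<lambda>t::real. f (q + t *\<^sub>R e)) differentiable (at 0))"

text \<open>
  \<open>rghr f \<mu> q\<close> and \<open>rghr_conj f \<mu> q\<close> are the right GHR derivatives of \<open>f\<close> at \<open>q\<close> with respect to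
  \<open>q\<^sup>\<mu>\<close> and to its conjugate. Whether they exist does not depend on \<open>\<mu>\<close>: it is
  \<open>has_partials f q\<close>.
\<close>

definition rghr :: "(quat \<Rightarrow> quat) \<Rightarrow> quat \<Rightarrow> quat \<Rightarrow> quat" where
  "rghr f \<mu> q = (1/4) *\<^sub>R (partial_deriv f 1 q - qrot \<mu> qi * partial_deriv f qi q
     - qrot \<mu> qj * partial_deriv f qj q - qrot \<mu> qk * partial_deriv f qk q)"

definition rghr_conj :: "(quat \<Rightarrow> quat) \<Rightarrow> quat \<Rightarrow> quat \<Rightarrow> quat" where
  "rghr_conj f \<mu> q = (1/4) *\<^sub>R (partial_deriv f 1 q + qrot \<mu> qi * partial_deriv f qi q
     + qrot \<mu> qj * partial_deriv f qj q + qrot \<mu> qk * partial_deriv f qk q)"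

end

theory Submission
  imports Defs
begin

text \<open>
  The chain rule has two independent ingredients, one algebraic and one analytic.

  Algebraically, summing a quaternion over the four rotations by \<open>\<nu>\<close>, \<open>\<nu>i\<close>, \<open>\<nu>j\<close>, \<open>\<nu>k\<close> leaves four
  times its real part, because conjugation by \<open>i\<close>, \<open>j\<close>, \<open>k\<close> flips the imaginary coordinates in pairs.
  Since rotations are multiplicative, \<open>h\<^sup>\<lambda> i\<^sup>\<lambda> = (h i)\<^sup>\<lambda>\<close>, so the same averaging applied to \<open>h\<close>, \<open>h i\<close>,
  \<open>h j\<close>, \<open>h k\<close> isolates the four real coordinates of \<open>h\<close>. Applied to the real-linear differential
  \<open>D\<close> of \<open>f\<close> at \<open>g q\<close> this yields
    \<open>D h = (\<Sum>\<lambda>. h\<^sup>\<lambda> * rghr f \<lambda> (g q)) = (\<Sum>\<lambda>. (h\<^sup>\<lambda>)\<^sup>* * rghr_conj f \<lambda> (g q))\<close>,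
  with \<open>\<lambda>\<close> running over \<open>\<nu>\<close>, \<open>\<nu>i\<close>, \<open>\<nu>j\<close>, \<open>\<nu>k\<close>,
  where the second equality comes from the same computation with the conjugate of \<open>h\<close>
  (\<open>differential_eq_sum_rghr\<close> and \<open>differential_eq_sum_rghr_conj\<close>).

  Analytically, the partial derivatives of \<open>f \<circ> g\<close> are the values of \<open>D\<close> at those of \<open>g\<close>
  (\<open>partial_deriv_compose\<close>); here the total differentiability of \<open>f\<close> is essential, while \<open>g\<close> is only
  ever restricted to lines. The right GHR derivatives multiply the partial derivatives by rotated
  units from the left, whereas in the formulas for \<open>D\<close> the derivatives of \<open>f\<close> stand on the right. So
  these factors can be pulled out, and any expansion of \<open>D\<close> of this shape turns into a chain
  rule (\<open>ghr_compose_sum\<close>).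
\<close>

section \<open>Rotations and the averaging identity\<close>

lemma qrot_mult:
  assumes "\<nu> \<noteq> 0"
  shows "qrot \<nu> (p * r) = qrot \<nu> p * qrot \<nu> r"
proof -
  have "\<nu> * (p * r) * inverse \<nu> = \<nu> * p * (inverse \<nu> * \<nu>) * r * inverse \<nu>"
    using assms by (simp add: mult.assoc[of \<nu> p r])
  then show ?thesis
    by (simp only: qrot_def mult.assoc)
qed

lemma qrot_of_real:
  assumes "\<nu> \<noteq> 0"
  shows "qrot \<nu> (of_real r) = of_real r"
  using assms by (simp add: qrot_def of_real_def)

lemma qrot_compose:
  assumes "\<nu> \<noteq> 0" "\<kappa> \<noteq> 0"
  shows "qrot (\<nu> * \<kappa>) p = qrot \<nu> (qrot \<kappa> p)"
  using assms by (simp add: qrot_def nonzero_inverse_mult_distrib mult.assoc)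

lemma bounded_linear_qrot: "bounded_linear (qrot \<nu>)"
  unfolding qrot_def
  by (intro bounded_linear_mult_const bounded_linear_const_mult bounded_linear_ident)

lemma qconj_sel [simp]: "qa (qconj p) = qa p" "qb (qconj p) = - qb p"
    "qc (qconj p) = - qc p" "qd (qconj p) = - qd p"
  by (simp_all add: qconj_def of_real_def qi_def qj_def qk_def)

lemma qconj_mult: "qconj (p * r) = qconj r * qconj p"
  by (rule quat_eqI) simp_all

lemma qconj_scaleR: "qconj (r *\<^sub>R p) = r *\<^sub>R qconj p"
  by (rule quat_eqI) simp_all

lemma qconj_qconj: "qconj (qconj p) = p"
  by (rule quat_eqI) simp_all

text \<open>
  The inverse of \<open>\<nu>\<close> is a real multiple of its conjugate, so reversing the order of the factors
  \<open>\<nu>\<close>, \<open>p\<close> and \<open>inverse \<nu>\<close> while conjugating them reproduces a rotation by \<open>\<nu>\<close>.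
\<close>

lemma qconj_qrot: "qconj (qrot \<nu> p) = qrot \<nu> (qconj p)"
proof -
  have "inverse \<nu> = qconj \<nu> /\<^sub>R (norm \<nu>)\<^sup>2"
    by (rule quat_eqI) (simp_all add: inverse_quat_def)
  then show ?thesis
    by (simp add: qrot_def qconj_mult qconj_scaleR qconj_qconj mult.assoc)
qed

lemma bounded_linear_qconj: "bounded_linear qconj"
proof (rule bounded_linear_intro)
  show "norm (qconj p) \<le> norm p * 1" for p
    by (simp add: norm_quat_def)
qed (rule quat_eqI; simp)+

lemma unit_quats_nonzero: "e \<in> {1, qi, qj, qk} \<Longrightarrow> e \<noteq> 0"
  by (auto simp: qi_def qj_def qk_def quat_eq_iff)

lemma sum_unit_quats: "(\<Sum>e\<in>{1, qi, qj, qk}. c e) = c 1 + c qi + c qj + c qk"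
  for c :: "quat \<Rightarrow> 'a::comm_monoid_add"
  by (simp add: qi_def qj_def qk_def quat_eq_iff add.assoc)

text \<open>
  For \<open>\<nu> = 1\<close>, conjugation by \<open>i\<close>, \<open>j\<close>, \<open>k\<close> keeps the real part and flips the sign of the other two
  imaginary coordinates, so each imaginary coordinate occurs twice with either sign. A general \<open>\<nu>\<close>
  then rotates the result, which is real and hence unmoved.
\<close>

lemma sum_rotations:
  assumes "\<nu> \<noteq> 0"
  shows "(\<Sum>e\<in>{1, qi, qj, qk}. qrot (\<nu> * e) p) = of_real (4 * qa p)"
proof -
  have "(\<Sum>e\<in>{1, qi, qj, qk}. qrot e p) = of_real (4 * qa p)"
    unfolding sum_unit_quats
    by (rule quat_eqI)
      (simp_all add: qrot_def of_real_def inverse_quat_def norm_quat_def qi_def qj_def qk_def)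
  moreover have "qrot (\<nu> * e) p = qrot \<nu> (qrot e p)" if "e \<in> {1, qi, qj, qk}" for e
    using qrot_compose[OF assms unit_quats_nonzero[OF that]] .
  ultimately show ?thesis
    using assms
    by (simp add: linear_sum[OF bounded_linear.linear[OF bounded_linear_qrot], symmetric]
        qrot_of_real del: sum.insert of_real_mult of_real_numeral)
qed

text \<open>
  Multiplying by an unrotated unit before averaging picks out the other coordinates of \<open>h\<close>. The
  coefficients \<open>A\<close>, \<open>B\<close>, \<open>C\<close>, \<open>D\<close> play the role of partial derivatives.
\<close>

lemma sum_rotations_mult:
  assumes "\<nu> \<noteq> 0"
  shows "(\<Sum>e\<in>{1, qi, qj, qk}. qrot (\<nu> * e) h * ((1/4) *\<^sub>R
            (A - qrot (\<nu> * e) qi * B - qrot (\<nu> * e) qj * C - qrot (\<nu> * e) qk * D)))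
         = qa h *\<^sub>R A + qb h *\<^sub>R B + qc h *\<^sub>R C + qd h *\<^sub>R D" (is "?lhs = ?rhs")
proof -
  have "qrot (\<nu> * e) h * ((1/4) *\<^sub>R
            (A - qrot (\<nu> * e) qi * B - qrot (\<nu> * e) qj * C - qrot (\<nu> * e) qk * D))
      = (1/4) *\<^sub>R (qrot (\<nu> * e) h * A - qrot (\<nu> * e) (h * qi) * B
            - qrot (\<nu> * e) (h * qj) * C - qrot (\<nu> * e) (h * qk) * D)"
    if "e \<in> {1, qi, qj, qk}" for e
    using assms unit_quats_nonzero[OF that] by (simp add: qrot_mult algebra_simps)
  then have "?lhs = (1/4) *\<^sub>R (of_real (4 * qa h) * A - of_real (4 * qa (h * qi)) * B
       - of_real (4 * qa (h * qj)) * C - of_real (4 * qa (h * qk)) * D)"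
    by (simp only: sum_rotations[OF assms, symmetric] sum_subtractf sum_distrib_right
        scaleR_sum_right[symmetric] cong: sum.cong)
  also have "\<dots> = ?rhs"
    by (rule quat_eqI) (simp_all add: of_real_def qi_def qj_def qk_def)
  finally show ?thesis .
qed

section \<open>Partial derivatives and the differential\<close>

text \<open>
  A partial derivative is a derivative along a line, so this is the chain rule for a curve through
  \<open>g q\<close> followed by a differentiable map.
\<close>

lemma has_vector_derivative_compose_partial:
  assumes F: "(F has_derivative F') (at (g q))"
    and g: "has_partials g q" and e: "e \<in> {1, qi, qj, qk}"
  shows "((\<lambda>t. F (g (q + t *\<^sub>R e))) has_vector_derivative F' (partial_deriv g e q)) (at 0)"
proof -
  have "((\<lambda>t. g (q + t *\<^sub>R e)) has_vector_derivative partial_deriv g e q) (at 0)"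
    using g e unfolding has_partials_def partial_deriv_def
    by (simp only: vector_derivative_works[symmetric])
  from has_derivative_compose[OF this[unfolded has_vector_derivative_def], of F F'] F
  show ?thesis
    by (simp add: has_vector_derivative_def
        linear_cmul[OF has_derivative_linear[OF F]])
qed

lemma partial_deriv_compose:
  assumes "(F has_derivative F') (at (g q))" "has_partials g q" "e \<in> {1, qi, qj, qk}"
  shows "partial_deriv (\<lambda>p. F (g p)) e q = F' (partial_deriv g e q)"
  unfolding partial_deriv_def[of "\<lambda>p. F (g p)"]
  by (rule vector_derivative_at[OF has_vector_derivative_compose_partial[OF assms]])

lemma has_partials_compose:
  assumes "(F has_derivative F') (at (g q))" "has_partials g q"
  shows "has_partials (\<lambda>p. F (g p)) q"
  unfolding has_partials_def
  using has_vector_derivative_compose_partial[OF assms] differentiableI_vector by blast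

lemma partial_deriv_eq_differential:
  assumes "(f has_derivative D) (at p)"
  shows "partial_deriv f e p = D e"
proof -
  have line: "((\<lambda>t::real. p + t *\<^sub>R e) has_derivative (\<lambda>t. t *\<^sub>R e)) (at 0)"
    by (auto intro!: derivative_eq_intros)
  have "((\<lambda>t. f (p + t *\<^sub>R e)) has_vector_derivative D e) (at 0)"
    using has_derivative_compose[OF line, of f D] assms
    by (simp add: has_vector_derivative_def linear_cmul[OF has_derivative_linear[OF assms]])
  then show ?thesis
    unfolding partial_deriv_def by (rule vector_derivative_at)
qed

lemma differential_eq_sum_partial_derivs:
  assumes "(f has_derivative D) (at p)"
  shows "D h = qa h *\<^sub>R partial_deriv f 1 p + qb h *\<^sub>R partial_deriv f qi p
    + qc h *\<^sub>R partial_deriv f qj p + qd h *\<^sub>R partial_deriv f qk p"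
proof -
  have "h = qa h *\<^sub>R 1 + qb h *\<^sub>R qi + qc h *\<^sub>R qj + qd h *\<^sub>R qk"
    by (rule quat_eqI) (simp_all add: qi_def qj_def qk_def)
  then have "D h = D (qa h *\<^sub>R 1 + qb h *\<^sub>R qi + qc h *\<^sub>R qj + qd h *\<^sub>R qk)"
    by (rule arg_cong)
  then show ?thesis
    using has_derivative_linear[OF assms]
    by (simp add: linear_add linear_cmul partial_deriv_eq_differential[OF assms])
qed

section \<open>Expanding the differential in right GHR derivatives\<close>

lemma differential_eq_sum_rghr:
  assumes "(f has_derivative D) (at p)" "\<nu> \<noteq> 0"
  shows "D h = (\<Sum>e\<in>{1, qi, qj, qk}. qrot (\<nu> * e) h * rghr f (\<nu> * e) p)"
  unfolding rghr_def sum_rotations_mult[OF assms(2)]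
  by (rule differential_eq_sum_partial_derivs[OF assms(1)])

text \<open>
  The conjugate derivative is the plain one with the three imaginary partial derivatives negated.
  Conjugating \<open>h\<close> negates its imaginary coordinates as well, so the two signs cancel in \<open>D h\<close>.
\<close>

lemma differential_eq_sum_rghr_conj:
  assumes "(f has_derivative D) (at p)" "\<nu> \<noteq> 0"
  shows "D h = (\<Sum>e\<in>{1, qi, qj, qk}. qconj (qrot (\<nu> * e) h) * rghr_conj f (\<nu> * e) p)"
proof -
  have "D h = qa (qconj h) *\<^sub>R partial_deriv f 1 p + qb (qconj h) *\<^sub>R (- partial_deriv f qi p)
    + qc (qconj h) *\<^sub>R (- partial_deriv f qj p) + qd (qconj h) *\<^sub>R (- partial_deriv f qk p)"
    by (simp add: differential_eq_sum_partial_derivs[OF assms(1), of h])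
  then show ?thesis
    unfolding sum_rotations_mult[OF assms(2), symmetric]
    by (simp add: rghr_conj_def qconj_qrot)
qed

section \<open>The chain rule\<close>

text \<open>
  Both kinds of derivative are sums of partial derivatives multiplied from the left, so right
  factors \<open>B e\<close> pass through them. Stated for an arbitrary expansion of the differential \<open>D\<close>, it
  serves the rotations and their conjugates alike.
\<close>

lemma ghr_compose_sum:
  assumes f: "(f has_derivative D) (at (g q))" and g: "has_partials g q"
    and A: "\<And>e. bounded_linear (A e)"
    and D: "\<And>h. D h = (\<Sum>e\<in>E. A e h * B e)"
  shows "rghr (\<lambda>p. f (g p)) \<mu> q = (\<Sum>e\<in>E. rghr (\<lambda>p. A e (g p)) \<mu> q * B e)"
    and "rghr_conj (\<lambda>p. f (g p)) \<mu> q = (\<Sum>e\<in>E. rghr_conj (\<lambda>p. A e (g p)) \<mu> q * B e)"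
proof -
  have "partial_deriv (\<lambda>p. f (g p)) u q = (\<Sum>e\<in>E. partial_deriv (\<lambda>p. A e (g p)) u q * B e)"
    if "u \<in> {1, qi, qj, qk}" for u
    using partial_deriv_compose[OF f g that] D
      partial_deriv_compose[OF bounded_linear_imp_has_derivative[OF A] g that]
    by simp
  then have *: "partial_deriv (\<lambda>p. f (g p)) 1 q = (\<Sum>e\<in>E. partial_deriv (\<lambda>p. A e (g p)) 1 q * B e)"
    "partial_deriv (\<lambda>p. f (g p)) qi q = (\<Sum>e\<in>E. partial_deriv (\<lambda>p. A e (g p)) qi q * B e)"
    "partial_deriv (\<lambda>p. f (g p)) qj q = (\<Sum>e\<in>E. partial_deriv (\<lambda>p. A e (g p)) qj q * B e)"
    "partial_deriv (\<lambda>p. f (g p)) qk q = (\<Sum>e\<in>E. partial_deriv (\<lambda>p. A e (g p)) qk q * B e)"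
    by simp_all
  show "rghr (\<lambda>p. f (g p)) \<mu> q = (\<Sum>e\<in>E. rghr (\<lambda>p. A e (g p)) \<mu> q * B e)"
    unfolding rghr_def *
    by (simp add: sum_subtractf sum.distrib sum_distrib_left scaleR_right.sum algebra_simps)
  show "rghr_conj (\<lambda>p. f (g p)) \<mu> q = (\<Sum>e\<in>E. rghr_conj (\<lambda>p. A e (g p)) \<mu> q * B e)"
    unfolding rghr_conj_def *
    by (simp add: sum_subtractf sum.distrib sum_distrib_left scaleR_right.sum algebra_simps)
qed

theorem theorem3p11:
  fixes f g :: "quat \<Rightarrow> quat" and S T :: "quat set" and q \<mu> \<nu> :: quat
  assumes "q \<in> interior S"
    and "has_partials g q"
    and "\<And>p. p \<in> S \<Longrightarrow> g p \<in> T"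
    and "g q \<in> interior T"
    and "has_partials f (g q)"
    and "f differentiable (at (g q))"
    and "\<mu> * \<nu> \<noteq> 0"
  shows "has_partials (\<lambda>p. f (g p)) q
  \<and> rghr (\<lambda>p. f (g p)) \<mu> q =
        rghr (\<lambda>p. qrot \<nu> (g p)) \<mu> q * rghr f \<nu> (g q)
      + rghr (\<lambda>p. qrot (\<nu> * qi) (g p)) \<mu> q * rghr f (\<nu> * qi) (g q)
      + rghr (\<lambda>p. qrot (\<nu> * qj) (g p)) \<mu> q * rghr f (\<nu> * qj) (g q)
      + rghr (\<lambda>p. qrot (\<nu> * qk) (g p)) \<mu> q * rghr f (\<nu> * qk) (g q)
  \<and> rghr_conj (\<lambda>p. f (g p)) \<mu> q =
        rghr_conj (\<lambda>p. qrot \<nu> (g p)) \<mu> q * rghr f \<nu> (g q)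
      + rghr_conj (\<lambda>p. qrot (\<nu> * qi) (g p)) \<mu> q * rghr f (\<nu> * qi) (g q)
      + rghr_conj (\<lambda>p. qrot (\<nu> * qj) (g p)) \<mu> q * rghr f (\<nu> * qj) (g q)
      + rghr_conj (\<lambda>p. qrot (\<nu> * qk) (g p)) \<mu> q * rghr f (\<nu> * qk) (g q)
  \<and> rghr (\<lambda>p. f (g p)) \<mu> q =
        rghr (\<lambda>p. qconj (qrot \<nu> (g p))) \<mu> q * rghr_conj f \<nu> (g q)
      + rghr (\<lambda>p. qconj (qrot (\<nu> * qi) (g p))) \<mu> q * rghr_conj f (\<nu> * qi) (g q)
      + rghr (\<lambda>p. qconj (qrot (\<nu> * qj) (g p))) \<mu> q * rghr_conj f (\<nu> * qj) (g q)
      + rghr (\<lambda>p. qconj (qrot (\<nu> * qk) (g p))) \<mu> q * rghr_conj f (\<nu> * qk) (g q)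
  \<and> rghr_conj (\<lambda>p. f (g p)) \<mu> q =
        rghr_conj (\<lambda>p. qconj (qrot \<nu> (g p))) \<mu> q * rghr_conj f \<nu> (g q)
      + rghr_conj (\<lambda>p. qconj (qrot (\<nu> * qi) (g p))) \<mu> q * rghr_conj f (\<nu> * qi) (g q)
      + rghr_conj (\<lambda>p. qconj (qrot (\<nu> * qj) (g p))) \<mu> q * rghr_conj f (\<nu> * qj) (g q)
      + rghr_conj (\<lambda>p. qconj (qrot (\<nu> * qk) (g p))) \<mu> q * rghr_conj f (\<nu> * qk) (g q)"
proof -
  obtain D where D: "(f has_derivative D) (at (g q))"
    using assms(6) by (auto simp: differentiable_def)
  have \<nu>: "\<nu> \<noteq> 0"
    using assms(7) by auto
  note plain = ghr_compose_sum[where A = "\<lambda>e. qrot (\<nu> * e)", OF D assms(2) bounded_linear_qrot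
      differential_eq_sum_rghr[OF D \<nu>]]
  note conj = ghr_compose_sum[where A = "\<lambda>e h. qconj (qrot (\<nu> * e) h)", OF D assms(2)
      bounded_linear_compose[OF bounded_linear_qconj bounded_linear_qrot]
      differential_eq_sum_rghr_conj[OF D \<nu>]]
  show ?thesis
    using has_partials_compose[OF D assms(2)]
      plain[of \<mu>, unfolded sum_unit_quats mult_1_right]
      conj[of \<mu>, unfolded sum_unit_quats mult_1_right]
    by (intro conjI)
qed

end
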